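(* Let $G=(V_G,E_G)$ be a simple graph with $V_G=\{1,\dots,n\}$ and $s=|E_G|\geq 2$, let $\mathbb{K}$ be a field, fix an ordering $e_1,\dots,e_s$ of $E_G$ (inducing identifications $\mathbb{N}^{E_G}\cong\mathbb{N}^s$ and $\mathbb{Z}^{E_G}\cong\mathbb{Z}^s$), and let $B$ be the $n\times s$ incidence matrix of $G$. Then the Eulerian ideal $I(G)\subseteq \mathbb{K}[E_G]$ is the lattice ideal associated with the lattice $$\mathcal{L}=\Bigl\{\theta\in\mathbb{Z}^s : B\theta\in(2\mathbb{Z})^n \text{ and } \sum_{e\in E_G}\theta(e)=0\Bigr\}.$$
   Context: $\mathbb{N}$ contains $0$. $\mathbb{K}[E_G]=\mathbb{K}[t_e: e\in E_G]$ is the polynomial ring with one variable for each edge of $G$, and for $\alpha\in\mathbb{N}^{E_G}$, $\mathbf{t}^\alpha=\prod_{e\in E_G}t_e^{\alpha(e)}$. Eulerian ideal: let $\varphi:\mathbb{K}[E_G]\to\mathbb{K}[x_1,\dots,x_n]$ be the $\mathbb{K}$-algebra homomorphism with $t_e\mapsto x_ix_j$ for every edge $e=\{i,j\}$. Then $I(G)=\varphi^{-1}\bigl((x_i^2-x_j^2 : i,j\in V_G)\bigr)$. Incidence matrix: $B_{ij}=1$ if vertex $i$ belongs to the edge $e_j$, and $B_{ij}=0$ otherwise. Lattice ideal: for a lattice (subgroup) $\mathcal{L}\subseteq\mathbb{Z}^s$, the lattice ideal associated with $\mathcal{L}$ is the ideal of $\mathbb{K}[E_G]$ generated by all $\mathbf{t}^\alpha-\mathbf{t}^\beta$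 with $\alpha,\beta\in\mathbb{N}^s$ and $\alpha-\beta\in\mathcal{L}$. *)

theory Defs
  imports
    "HOL-Library.Poly_Mapping"
    "HOL-Algebra.RingHom"
    "Jordan_Normal_Form.Matrix"
begin

definition simple_graph :: "'v set \<Rightarrow> 'v set set \<Rightarrow> bool" where
  "simple_graph V E \<longleftrightarrow> finite V \<and> E \<subseteq> {{i, j} | i j. i \<in> V \<and> j \<in> V \<and> i \<noteq> j}"

section \<open>Polynomials over a set of variables\<close>

text \<open>
  A polynomial is a finitely supported map from monomials to coefficients, a monomial is a
  finitely supported map from variables to exponents; multiplication is convolution.
\<close>

type_synonym ('v, 'k) mpol = "('v \<Rightarrow>\<^sub>0 nat) \<Rightarrow>\<^sub>0 'k"

text \<open>The ring \<open>K[x : x \<in> X]\<close>, as a subring of the polynomials in all elements of the type.\<close>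

definition mpol_ring :: "'v set \<Rightarrow> ('v, 'k::comm_ring_1) mpol ring" where
  "mpol_ring X =
    \<lparr>carrier = {p. \<forall>m \<in> Poly_Mapping.keys p. Poly_Mapping.keys m \<subseteq> X},
     monoid.mult = (*), one = 1, zero = 0, add = (+)\<rparr>"

definition mconst :: "'k::comm_ring_1 \<Rightarrow> ('v, 'k) mpol" where
  "mconst c = Poly_Mapping.single 0 c"

definition mvar :: "'v \<Rightarrow> ('v, 'k::comm_ring_1) mpol" where
  "mvar v = Poly_Mapping.single (Poly_Mapping.single v 1) 1"

definition msubst :: "('v \<Rightarrow> ('w, 'k::comm_ring_1) mpol) \<Rightarrow> ('v, 'k) mpol \<Rightarrow> ('w, 'k) mpol" where
  "msubst f p =
    (\<Sum>m \<in> Poly_Mapping.keys p. mconst (Poly_Mapping.lookup p m) *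
       (\<Prod>v \<in> Poly_Mapping.keys m. f v ^ Poly_Mapping.lookup m v))"

section \<open>The Eulerian ideal\<close>

text \<open>For an edge \<open>e = {i, j}\<close> with \<open>i \<noteq> j\<close> the product below is \<open>x\<^sub>i x\<^sub>j\<close>.\<close>

definition euler_hom :: "('v set, 'k::comm_ring_1) mpol \<Rightarrow> ('v, 'k) mpol" where
  "euler_hom = msubst (\<lambda>e. \<Prod>i \<in> e. mvar i)"

definition eulerian_ideal :: "'v set \<Rightarrow> 'v set set \<Rightarrow> ('v set, 'k::field) mpol set" where
  "eulerian_ideal V E =
    {p \<in> carrier (mpol_ring E).
       euler_hom p \<in> Idl\<^bsub>mpol_ring V\<^esub> {mvar i ^ 2 - mvar j ^ 2 | i j. i \<in> V \<and> j \<in> V}}"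

section \<open>Lattice ideals\<close>

text \<open>
  Below, \<open>es\<close> lists the edges. Vectors and matrices are indexed from 0: column \<open>j\<close> belongs to the
  edge \<open>es ! j\<close>, and row \<open>i\<close> of the incidence matrix to the vertex \<open>i + 1\<close>.
\<close>

definition tmonom :: "'e list \<Rightarrow> nat vec \<Rightarrow> ('e, 'k::comm_ring_1) mpol" where
  "tmonom es \<alpha> = (\<Prod>j<length es. mvar (es ! j) ^ (\<alpha> $ j))"

definition lattice_ideal :: "'e list \<Rightarrow> int vec set \<Rightarrow> ('e, 'k::field) mpol set" where
  "lattice_ideal es L =
    Idl\<^bsub>mpol_ring (set es)\<^esub>
      {tmonom es \<alpha> - tmonom es \<beta> | \<alpha> \<beta>.
         \<alpha> \<in> carrier_vec (length es) \<and> \<beta> \<in> carrier_vec (length es) \<and>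
         map_vec int \<alpha> - map_vec int \<beta> \<in> L}"

definition incidence_mat :: "nat \<Rightarrow> nat set list \<Rightarrow> int mat" where
  "incidence_mat n es = mat n (length es) (\<lambda>(i, j). if i + 1 \<in> es ! j then 1 else 0)"

definition eulerian_lattice :: "nat \<Rightarrow> nat set list \<Rightarrow> int vec set" where
  "eulerian_lattice n es =
    {\<theta> \<in> carrier_vec (length es).
       (\<forall>i<n. even ((incidence_mat n es *\<^sub>v \<theta>) $ i)) \<and> (\<Sum>j<length es. \<theta> $ j) = 0}"

section \<open>Basic properties\<close>

lemma subgroup_eulerian_lattice:
  "subgroup (eulerian_lattice n es) (monoid_vec TYPE(int) (length es))"
proof -
  let ?s = "length es" and ?B = "incidence_mat n es"
  interpret G: comm_group "monoid_vec TYPE(int) ?s" by (rule comm_group_vec)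
  have B: "?B \<in> carrier_mat n ?s" by (simp add: incidence_mat_def)
  have inv: "inv\<^bsub>monoid_vec TYPE(int) ?s\<^esub> x = - x" if "x \<in> carrier_vec ?s" for x
    by (rule G.inv_equality) (use that in \<open>auto simp: monoid_vec_simps\<close>)
  show ?thesis
  proof (rule G.subgroupI)
    have "0\<^sub>v ?s \<in> eulerian_lattice n es"
      using B by (auto simp: eulerian_lattice_def)
    then show "eulerian_lattice n es \<noteq> {}" by blast
  next
    fix x assume x: "x \<in> eulerian_lattice n es"
    then have c: "x \<in> carrier_vec ?s" by (simp add: eulerian_lattice_def)
    have "(?B *\<^sub>v (- x)) $ i = - ((?B *\<^sub>v x) $ i)" if "i < n" for i
      using B c that by auto
    moreover have "(\<Sum>j<?s. (- x) $ j) = - (\<Sum>j<?s. x $ j)"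
      using c by (simp add: sum_negf)
    ultimately show "inv\<^bsub>monoid_vec TYPE(int) ?s\<^esub> x \<in> eulerian_lattice n es"
      using x by (simp add: inv[OF c]) (auto simp: eulerian_lattice_def)
  next
    fix x y assume x: "x \<in> eulerian_lattice n es" and y: "y \<in> eulerian_lattice n es"
    then have c: "x \<in> carrier_vec ?s" "y \<in> carrier_vec ?s" by (auto simp: eulerian_lattice_def)
    have "(?B *\<^sub>v (x + y)) $ i = (?B *\<^sub>v x) $ i + (?B *\<^sub>v y) $ i" if "i < n" for i
      using B c that by (simp add: mult_add_distrib_mat_vec)
    moreover have "(\<Sum>j<?s. (x + y) $ j) = (\<Sum>j<?s. x $ j) + (\<Sum>j<?s. y $ j)"
      using c by (simp add: sum.distrib)
    ultimately show "x \<otimes>\<^bsub>monoid_vec TYPE(int) ?s\<^esub> y \<in> eulerian_lattice n es"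
      using x y by (auto simp: eulerian_lattice_def monoid_vec_simps)
  qed (auto simp: eulerian_lattice_def monoid_vec_simps)
qed

lemma cring_mpol_ring: "cring (mpol_ring X :: ('v, 'k::comm_ring_1) mpol ring)"
proof -
  let ?C = "carrier (mpol_ring X) :: ('v, 'k) mpol set"
  have add: "p + q \<in> ?C" if "p \<in> ?C" "q \<in> ?C" for p q
    using that Poly_Mapping.keys_add[of p q] by (auto simp: mpol_ring_def)
  have neg: "- p \<in> ?C" if "p \<in> ?C" for p
    using that by (auto simp: mpol_ring_def in_keys_iff)
  have mult: "p * q \<in> ?C" if "p \<in> ?C" "q \<in> ?C" for p q
  proof -
    have "Poly_Mapping.keys m \<subseteq> X" if "m \<in> Poly_Mapping.keys (p * q)" for m
    proof -
      obtain a b where m: "m = a + b" and "a \<in> Poly_Mapping.keys p" "b \<in> Poly_Mapping.keys q"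
        using \<open>m \<in> _\<close> Poly_Mapping.keys_mult[of p q] by blast
      then have "Poly_Mapping.keys a \<subseteq> X" "Poly_Mapping.keys b \<subseteq> X"
        using \<open>p \<in> ?C\<close> \<open>q \<in> ?C\<close> by (simp_all add: mpol_ring_def)
      then show ?thesis
        unfolding m using Poly_Mapping.keys_add[of a b] by blast
    qed
    then show ?thesis by (simp add: mpol_ring_def)
  qed
  have one: "1 \<in> ?C" and zero: "0 \<in> ?C" by (simp_all add: mpol_ring_def)
  have ops: "x \<oplus>\<^bsub>mpol_ring X\<^esub> y = x + y" "x \<otimes>\<^bsub>mpol_ring X\<^esub> y = x * y"
    "\<one>\<^bsub>mpol_ring X\<^esub> = 1" "\<zero>\<^bsub>mpol_ring X\<^esub> = 0" for x y :: "('v, 'k) mpol"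
    by (simp_all add: mpol_ring_def)
  show ?thesis
  proof (rule cringI)
    show "abelian_group (mpol_ring X :: ('v, 'k) mpol ring)"
    proof (rule abelian_groupI)
      fix p assume "p \<in> ?C"
      then show "\<exists>q \<in> ?C. q \<oplus>\<^bsub>mpol_ring X\<^esub> p = \<zero>\<^bsub>mpol_ring X\<^esub>"
        using neg[of p] by (intro bexI[of _ "- p"]) (simp_all add: ops)
    qed (simp_all add: ops add zero add_ac)
    show "comm_monoid (mpol_ring X :: ('v, 'k) mpol ring)"
      by (rule comm_monoidI) (simp_all add: ops mult one mult_ac)
  qed (simp add: ops distrib_right)
qed

lemma mconst_in_mpol_ring: "mconst c \<in> carrier (mpol_ring X)"
  by (simp add: mconst_def mpol_ring_def)

lemma mvar_in_mpol_ring: "v \<in> X \<Longrightarrow> mvar v \<in> carrier (mpol_ring X)"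
  by (simp add: mvar_def mpol_ring_def)

lemma mconst_add: "mconst (a + b) = mconst a + mconst b"
  by (simp add: mconst_def Poly_Mapping.single_add)

lemma mconst_mult: "mconst (a * b) = mconst a * mconst b"
  by (simp add: mconst_def Poly_Mapping.mult_single)

lemma msubst_superset:
  assumes "finite S" "Poly_Mapping.keys p \<subseteq> S"
  shows "msubst f p = (\<Sum>m \<in> S. mconst (Poly_Mapping.lookup p m) *
           (\<Prod>v \<in> Poly_Mapping.keys m. f v ^ Poly_Mapping.lookup m v))"
  unfolding msubst_def using assms
  by (intro sum.mono_neutral_left) (auto simp: in_keys_iff mconst_def)

lemma msubst_add: "msubst f (p + q) = msubst f p + msubst f q"
  using Poly_Mapping.keys_add[of p q]
  by (simp add: msubst_superset[where S = "Poly_Mapping.keys p \<union> Poly_Mapping.keys q"]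
      Poly_Mapping.lookup_add mconst_add sum.distrib ring_distribs)

lemma msubst_single:
  "msubst f (Poly_Mapping.single m c) =
     mconst c * (\<Prod>v \<in> Poly_Mapping.keys m. f v ^ Poly_Mapping.lookup m v)"
  by (simp add: msubst_superset[where S = "{m}"])

lemma msubst_mconst: "msubst f (mconst c) = mconst c"
  by (simp add: mconst_def[of c] msubst_single)

lemma msubst_mvar: "msubst f (mvar v) = f v"
  by (simp add: mvar_def msubst_single mconst_def)

lemma mpol_induct [case_names zero single add]:
  fixes p :: "('v, 'k::comm_ring_1) mpol"
  assumes "P 0" "\<And>m c. P (Poly_Mapping.single m c)" "\<And>p q. P p \<Longrightarrow> P q \<Longrightarrow> P (p + q)"
  shows "P p"
proof (induction p rule: Poly_Mapping.update_induct)
  case (update p m c)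
  have "Poly_Mapping.update m c p = p + Poly_Mapping.single m c"
    using update.hyps
    by (intro poly_mapping_eqI)
      (auto simp: lookup_update Poly_Mapping.lookup_add lookup_single in_keys_iff when_def)
  then show ?case using assms update.IH by metis
qed (fact assms)

lemma msubst_mult: "msubst f (p * q) = msubst f p * msubst f q"
proof -
  have zero: "msubst f 0 = 0" by (simp add: msubst_def)
  have prod_add:
    "(\<Prod>v \<in> Poly_Mapping.keys (a + b). f v ^ Poly_Mapping.lookup (a + b) v) =
     (\<Prod>v \<in> Poly_Mapping.keys a. f v ^ Poly_Mapping.lookup a v) *
     (\<Prod>v \<in> Poly_Mapping.keys b. f v ^ Poly_Mapping.lookup b v)" for a b
  proof -
    let ?S = "Poly_Mapping.keys a \<union> Poly_Mapping.keys b"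
    have "(\<Prod>v \<in> Poly_Mapping.keys m. f v ^ Poly_Mapping.lookup m v) =
          (\<Prod>v \<in> ?S. f v ^ Poly_Mapping.lookup m v)" if "Poly_Mapping.keys m \<subseteq> ?S" for m
      by (rule prod.mono_neutral_left) (use that in \<open>auto simp: in_keys_iff\<close>)
    from this[of a] this[of b] this[OF Poly_Mapping.keys_add] show ?thesis
      by (simp add: Poly_Mapping.lookup_add power_add prod.distrib)
  qed
  have single: "msubst f (Poly_Mapping.single m c * q) = msubst f (Poly_Mapping.single m c) * msubst f q"
    for m c
  proof (induction q rule: mpol_induct)
    case (add p q)
    then show ?case by (simp only: distrib_left msubst_add)
  qed (simp_all add: zero Poly_Mapping.mult_single msubst_single mconst_mult prod_add mult_ac)
  show ?thesis
    by (induction p rule: mpol_induct) (simp_all add: zero single distrib_right msubst_add)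
qed

lemma euler_hom_edge: "i \<noteq> j \<Longrightarrow> euler_hom (mvar {i, j}) = mvar i * mvar j"
  by (simp add: euler_hom_def msubst_mvar)

lemma euler_hom_mconst: "euler_hom (mconst c) = mconst c"
  by (simp add: euler_hom_def msubst_mconst)

lemma euler_hom_ring_hom:
  assumes "simple_graph V E"
  shows "euler_hom \<in> Ring.ring_hom (mpol_ring E) (mpol_ring V :: ('v, 'k::comm_ring_1) mpol ring)"
proof (rule ring_hom_memI)
  interpret R: cring "mpol_ring V :: ('v, 'k) mpol ring" by (rule cring_mpol_ring)
  let ?C = "carrier (mpol_ring V) :: ('v, 'k) mpol set"
  have one: "1 \<in> ?C" and zero: "0 \<in> ?C" by (auto simp: mpol_ring_def)
  have mult: "p * q \<in> ?C" if "p \<in> ?C" "q \<in> ?C" for p q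
    using R.m_closed[OF that] by (simp add: mpol_ring_def)
  have add: "p + q \<in> ?C" if "p \<in> ?C" "q \<in> ?C" for p q
    using R.a_closed[OF that] by (simp add: mpol_ring_def)
  have prod: "prod g A \<in> ?C" if "\<And>a. a \<in> A \<Longrightarrow> g a \<in> ?C" for A and g :: "'b \<Rightarrow> _"
    using that by (induction A rule: infinite_finite_induct) (auto simp: one mult)
  have sum: "sum g A \<in> ?C" if "\<And>a. a \<in> A \<Longrightarrow> g a \<in> ?C" for A and g :: "'b \<Rightarrow> _"
    using that by (induction A rule: infinite_finite_induct) (auto simp: zero add)
  have pow: "p ^ k \<in> ?C" if "p \<in> ?C" for p and k :: nat
    using that by (induction k) (auto simp: one mult)
  have edge: "(\<Prod>i \<in> e. mvar i) \<in> ?C" if "e \<in> E" for e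
    using that assms unfolding simple_graph_def
    by (intro prod mvar_in_mpol_ring) blast
  fix p :: "('v set, 'k) mpol" assume p: "p \<in> carrier (mpol_ring E)"
  show "euler_hom p \<in> ?C"
    unfolding euler_hom_def msubst_def
    by (intro sum mult prod pow mconst_in_mpol_ring edge) (use p in \<open>auto simp: mpol_ring_def\<close>)
next
  show "euler_hom \<one>\<^bsub>mpol_ring E\<^esub> = (\<one>\<^bsub>mpol_ring V\<^esub> :: ('v, 'k) mpol)"
    using euler_hom_mconst[of "1 :: 'k"] by (simp add: mpol_ring_def mconst_def)
qed (simp_all add: euler_hom_def mpol_ring_def msubst_add msubst_mult)

end

theory Submission
  imports Defs
begin

text \<open>
  Both ideals are instances of one construction. Let \<open>w\<close> be a labelling of monomials that is
  compatible with multiplication: equal labels stay equal after multiplication by a common monomial.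
  The differences \<open>x\<^sup>u - x\<^sup>v\<close> with \<open>w u = w v\<close> generate an ideal, and a polynomial lies in it iff its
  coefficients sum to zero over every class of equally labelled monomials. The latter says that
  every linear functional whose value on a monomial depends only on the label annihilates the
  polynomial; this is the form of lemma \<open>genideal_fibre_binomials\<close>. In one direction, functionals of
  this kind annihilate the generators, and so do their compositions with multiplication by a
  monomial. In the other direction, a polynomial whose class sums vanish is unchanged when each
  monomial \<open>x\<^sup>m\<close> is replaced by its difference from a fixed representative of its class.

  In \<open>K[x\<^sub>1, \<dots>, x\<^sub>n]\<close> label a monomial by the parities of its exponents and by its degree. The
  ideal of the differences \<open>x\<^sub>i\<^sup>2 - x\<^sub>j\<^sup>2\<close> is the ideal of this labelling
  (\<open>genideal_square_differences\<close>): for a fixed vertex \<open>k\<close>, squares of other variables can be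
  traded for \<open>x\<^sub>k\<^sup>2\<close> until all exponents outside \<open>k\<close> are at most 1, and what remains is determined
  by the parities and the degree.

  The homomorphism \<open>\<phi>\<close> sends a monomial in the edges to the monomial of its vertex degrees, so a
  label functional composed with \<open>\<phi>\<close> is a label functional for the pulled-back labelling. Hence
  \<open>I(G)\<close> is the ideal of the pulled-back labelling on \<open>K[E\<^sub>G]\<close>. Finally \<open>\<alpha>\<close> and \<open>\<beta>\<close> have the same
  pulled-back label iff \<open>B(\<alpha> - \<beta>)\<close> is even and \<open>\<alpha>\<close>, \<open>\<beta>\<close> have the same total, because \<open>\<phi>\<close> doubles
  degrees: this is \<open>\<alpha> - \<beta> \<in> \<L>\<close>, so the generators are exactly those of the lattice ideal.
\<close>

section \<open>Ideals of the polynomial ring\<close>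

lemma mpol_ring_simps:
  "x \<oplus>\<^bsub>mpol_ring X\<^esub> y = x + y" "x \<otimes>\<^bsub>mpol_ring X\<^esub> y = x * y"
  "\<one>\<^bsub>mpol_ring X\<^esub> = 1" "\<zero>\<^bsub>mpol_ring X\<^esub> = 0"
  by (simp_all add: mpol_ring_def)

lemma carrier_mpol_ring:
  "p \<in> carrier (mpol_ring X) \<longleftrightarrow> (\<forall>m \<in> Poly_Mapping.keys p. Poly_Mapping.keys m \<subseteq> X)"
  by (simp add: mpol_ring_def)

lemma single_in_mpol_ring:
  "Poly_Mapping.keys m \<subseteq> X \<Longrightarrow> Poly_Mapping.single m c \<in> carrier (mpol_ring X)"
  by (simp add: carrier_mpol_ring)

context
  fixes I :: "('v, 'k::comm_ring_1) mpol set" and X :: "'v set"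
  assumes I: "ideal I (mpol_ring X)"
begin

lemma ideal_zero: "0 \<in> I"
  using additive_subgroup.zero_closed[OF ideal.axioms(1)[OF I]] by (simp add: mpol_ring_simps)

lemma ideal_add: "p \<in> I \<Longrightarrow> q \<in> I \<Longrightarrow> p + q \<in> I"
  using additive_subgroup.a_closed[OF ideal.axioms(1)[OF I]] by (simp add: mpol_ring_simps)

lemma ideal_mult: "p \<in> I \<Longrightarrow> q \<in> carrier (mpol_ring X) \<Longrightarrow> q * p \<in> I"
  using ideal.I_l_closed[OF I] by (simp add: mpol_ring_simps)

lemma ideal_diff:
  assumes "p \<in> I" "q \<in> I" shows "p - q \<in> I"
proof -
  have "mconst (- 1) * q = - q"
    by (simp add: mconst_def single_uminus)
  then show ?thesis
    using ideal_add[OF assms(1) ideal_mult[OF assms(2) mconst_in_mpol_ring[of "- 1"]]] by simp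
qed

lemma ideal_sum: "(\<And>a. a \<in> A \<Longrightarrow> g a \<in> I) \<Longrightarrow> sum g A \<in> I"
  by (induction A rule: infinite_finite_induct) (auto simp: ideal_zero ideal_add)

end

section \<open>Ideals generated by differences of equivalent monomials\<close>

text \<open>The linear functional on polynomials whose value on the monomial \<open>m\<close> is \<open>\<chi> m\<close>.\<close>

definition weighted_sum :: "(('v \<Rightarrow>\<^sub>0 nat) \<Rightarrow> 'k) \<Rightarrow> ('v, 'k::comm_ring_1) mpol \<Rightarrow> 'k" where
  "weighted_sum \<chi> p = (\<Sum>m \<in> Poly_Mapping.keys p. Poly_Mapping.lookup p m * \<chi> m)"

lemma weighted_sum_superset:
  assumes "finite S" "Poly_Mapping.keys p \<subseteq> S"
  shows "weighted_sum \<chi> p = (\<Sum>m \<in> S. Poly_Mapping.lookup p m * \<chi> m)"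
  unfolding weighted_sum_def using assms
  by (intro sum.mono_neutral_left) (auto simp: in_keys_iff)

lemma weighted_sum_zero [simp]: "weighted_sum \<chi> 0 = 0"
  by (simp add: weighted_sum_def)

lemma weighted_sum_add: "weighted_sum \<chi> (p + q) = weighted_sum \<chi> p + weighted_sum \<chi> q"
  using Poly_Mapping.keys_add[of p q]
  by (simp add: weighted_sum_superset[where S = "Poly_Mapping.keys p \<union> Poly_Mapping.keys q"]
      Poly_Mapping.lookup_add sum.distrib ring_distribs)

lemma weighted_sum_single: "weighted_sum \<chi> (Poly_Mapping.single m c) = c * \<chi> m"
  by (simp add: weighted_sum_superset[where S = "{m}"])

lemma weighted_sum_single_mult:
  "weighted_sum \<chi> (Poly_Mapping.single m c * p) = c * weighted_sum (\<lambda>u. \<chi> (m + u)) p"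
  by (induction p rule: mpol_induct)
    (simp_all add: distrib_left weighted_sum_add weighted_sum_single Poly_Mapping.mult_single mult.assoc)

lemma weighted_sum_diff:
  "weighted_sum \<chi> (p - q) = weighted_sum \<chi> p - weighted_sum \<chi> q"
  using weighted_sum_add[of \<chi> "p - q" q] by simp

definition fibre_binomials :: "'v set \<Rightarrow> (('v \<Rightarrow>\<^sub>0 nat) \<Rightarrow> 'c) \<Rightarrow> ('v, 'k::comm_ring_1) mpol set" where
  "fibre_binomials X w =
    {Poly_Mapping.single u 1 - Poly_Mapping.single v 1 | u v.
       Poly_Mapping.keys u \<subseteq> X \<and> Poly_Mapping.keys v \<subseteq> X \<and> w u = w v}"

lemma fibre_binomials_subset_carrier:
  "fibre_binomials X w \<subseteq> carrier (mpol_ring X)"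
proof
  fix p :: "('a, 'b) mpol" assume "p \<in> fibre_binomials X w"
  then obtain u v where p: "p = Poly_Mapping.single u 1 - Poly_Mapping.single v 1"
    and uv: "Poly_Mapping.keys u \<subseteq> X" "Poly_Mapping.keys v \<subseteq> X"
    by (auto simp: fibre_binomials_def)
  have "Poly_Mapping.keys p \<subseteq> {u, v}"
    unfolding p using keys_diff[of "Poly_Mapping.single u 1 :: ('a, 'b) mpol" "Poly_Mapping.single v 1"]
    by auto
  then show "p \<in> carrier (mpol_ring X)"
    using uv by (auto simp: carrier_mpol_ring)
qed

text \<open>
  Closure under multiplication is the point here. It is enough to multiply by one monomial \<open>m\<close>, and
  the functional \<open>p \<mapsto> weighted_sum (\<chi> \<circ> w) (x\<^sup>m p)\<close> again depends on labels only.
\<close>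

lemma ideal_vanishing_weighted_sums:
  assumes w: "\<And>m u v. w u = w v \<Longrightarrow> w (m + u) = w (m + v)"
  shows "ideal {p \<in> carrier (mpol_ring X). \<forall>\<chi>. weighted_sum (\<chi> \<circ> w) p = (0 :: 'k::comm_ring_1)}
           (mpol_ring X)" (is "ideal ?K ?R")
proof -
  interpret R: cring ?R by (rule cring_mpol_ring)
  have uminus: "- p \<in> carrier ?R" if "p \<in> carrier ?R" for p
    using that by (simp add: carrier_mpol_ring in_keys_iff)
  have mult: "weighted_sum (\<chi> \<circ> w) (q * p) = 0" if p: "p \<in> ?K" for p q :: "('a, 'k) mpol" and \<chi>
  proof (induction q rule: mpol_induct)
    case (single m c)
    \<comment> \<open>\<open>\<chi>'\<close> reads off \<open>\<chi> (w (m + u))\<close> from \<open>w u\<close>; by hypothesis the choice of \<open>u\<close> does not matter.\<close>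
    define \<chi>' where "\<chi>' c = \<chi> (w (m + (SOME u. w u = c)))" for c
    have "\<chi> (w (m + u)) = \<chi>' (w u)" for u
      unfolding \<chi>'_def using w[of u "SOME u'. w u' = w u"] someI[of "\<lambda>u'. w u' = w u" u] by metis
    then have "(\<lambda>u. (\<chi> \<circ> w) (m + u)) = \<chi>' \<circ> w" by (simp add: fun_eq_iff)
    then show ?case using p by (simp add: weighted_sum_single_mult)
  qed (simp_all add: distrib_right weighted_sum_add)
  show ?thesis
  proof (rule idealI)
    show "ring ?R" by (rule R.ring_axioms)
    show "subgroup ?K (add_monoid ?R)"
    proof (rule R.add.subgroupI)
      fix p assume p: "p \<in> ?K"
      have "\<ominus>\<^bsub>?R\<^esub> p = - p"
        by (rule R.minus_equality) (use p uminus in \<open>auto simp: mpol_ring_simps\<close>)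
      moreover have "weighted_sum (\<chi> \<circ> w) (- p) = 0" for \<chi>
        using p weighted_sum_diff[of "\<chi> \<circ> w" 0 p] by simp
      ultimately show "\<ominus>\<^bsub>?R\<^esub> p \<in> ?K" using p uminus by simp
    next
      fix p q assume "p \<in> ?K" "q \<in> ?K"
      then show "p \<oplus>\<^bsub>?R\<^esub> q \<in> ?K"
        using R.a_closed[of p q] by (simp add: mpol_ring_simps weighted_sum_add)
    next
      have "0 \<in> ?K" by (simp add: carrier_mpol_ring)
      then show "?K \<noteq> {}" by blast
    qed auto
  next
    fix p q assume p: "p \<in> ?K" and q: "q \<in> carrier ?R"
    show "q \<otimes>\<^bsub>?R\<^esub> p \<in> ?K"
      using mult[OF p] p q R.m_closed[of q p] by (simp add: mpol_ring_simps)
    then show "p \<otimes>\<^bsub>?R\<^esub> q \<in> ?K"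
      by (simp add: mpol_ring_simps mult.commute)
  qed
qed

lemma mpol_as_sum:
  "p = (\<Sum>m \<in> Poly_Mapping.keys p. Poly_Mapping.single m (Poly_Mapping.lookup p m))"
  by (rule poly_mapping_eqI) (simp add: lookup_sum lookup_single when_def in_keys_iff)

lemma sum_single:
  "(\<Sum>a \<in> A. Poly_Mapping.single m (f a)) = Poly_Mapping.single m (sum f A)"
  by (induction A rule: infinite_finite_induct) (simp_all add: Poly_Mapping.single_add)

text \<open>
  Writing \<open>r\<^sub>m\<close> for the representative of the class of \<open>m\<close>, the sum of the terms \<open>p\<^sub>m x\<^bsup>r\<^sub>m\<^esup>\<close> is zero,
  since the coefficient of each representative is a class sum. Subtracting it from \<open>p\<close> exhibits
  \<open>p\<close> as a combination of the binomials \<open>x\<^sup>m - x\<^bsup>r\<^sub>m\<^esup>\<close>.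
\<close>

lemma mem_ideal_if_weighted_sums_vanish:
  fixes p :: "('v, 'k::comm_ring_1) mpol"
  assumes I: "ideal I (mpol_ring X)" and gens: "fibre_binomials X w \<subseteq> I"
    and p: "p \<in> carrier (mpol_ring X)" and vanish: "\<And>\<chi>. weighted_sum (\<chi> \<circ> w) p = 0"
  shows "p \<in> I"
proof -
  let ?K = "Poly_Mapping.keys p" and ?a = "Poly_Mapping.lookup p"
  define rep where "rep c = (SOME u. Poly_Mapping.keys u \<subseteq> X \<and> w u = c)" for c
  have rep: "Poly_Mapping.keys (rep (w m)) \<subseteq> X \<and> w (rep (w m)) = w m" if "m \<in> ?K" for m
    unfolding rep_def by (rule someI[of _ m]) (use p that in \<open>simp add: carrier_mpol_ring\<close>)
  have class_sum: "(\<Sum>m \<in> {m \<in> ?K. w m = c}. ?a m) = 0" for c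
    \<comment> \<open>the functional that is the indicator of the class labelled \<open>c\<close>\<close>
    using vanish[of "\<lambda>d. if d = c then 1 else 0"]
    by (simp add: weighted_sum_def sum.If_cases if_distrib[of "\<lambda>x. _ * x"] Int_def cong: if_cong)
  have "(\<Sum>m \<in> ?K. Poly_Mapping.single (rep (w m)) (?a m)) =
        (\<Sum>c \<in> w ` ?K. \<Sum>m \<in> {m \<in> ?K. w m = c}. Poly_Mapping.single (rep (w m)) (?a m))"
    by (rule sum.image_gen) simp
  also have "\<dots> = (\<Sum>c \<in> w ` ?K. Poly_Mapping.single (rep c) (\<Sum>m \<in> {m \<in> ?K. w m = c}. ?a m))"
    unfolding sum_single[symmetric] by (intro sum.cong refl) auto
  finally have reps: "(\<Sum>m \<in> ?K. Poly_Mapping.single (rep (w m)) (?a m)) = 0"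
    by (simp add: class_sum)
  have "p = (\<Sum>m \<in> ?K. Poly_Mapping.single m (?a m) - Poly_Mapping.single (rep (w m)) (?a m))"
    unfolding sum_subtractf reps diff_zero by (rule mpol_as_sum)
  also have "\<dots> = (\<Sum>m \<in> ?K. mconst (?a m) *
      (Poly_Mapping.single m 1 - Poly_Mapping.single (rep (w m)) 1))"
    by (simp add: mconst_def right_diff_distrib Poly_Mapping.mult_single)
  also have "\<dots> \<in> I"
  proof (intro ideal_sum[OF I] ideal_mult[OF I] mconst_in_mpol_ring)
    fix m assume m: "m \<in> ?K"
    then show "Poly_Mapping.single m 1 - Poly_Mapping.single (rep (w m)) 1 \<in> I"
      using rep[OF m] p by (intro subsetD[OF gens]) (force simp: fibre_binomials_def carrier_mpol_ring)
  qed
  finally show ?thesis .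
qed

text \<open>
  Quantifying over all \<open>\<chi>\<close>, rather than over the indicators of single classes, makes the criterion
  stable under substitutions of monomials: they only compose \<open>w\<close> with another map.
\<close>

theorem genideal_fibre_binomials:
  assumes w: "\<And>m u v. w u = w v \<Longrightarrow> w (m + u) = w (m + v)"
  shows "Idl\<^bsub>mpol_ring X\<^esub> (fibre_binomials X w) =
           {p \<in> carrier (mpol_ring X). \<forall>\<chi>. weighted_sum (\<chi> \<circ> w) p = (0 :: 'k::comm_ring_1)}"
proof -
  let ?R = "mpol_ring X :: ('a, 'k) mpol ring"
  interpret R: cring ?R by (rule cring_mpol_ring)
  have "fibre_binomials X w \<subseteq>
      {p \<in> carrier ?R. \<forall>\<chi>. weighted_sum (\<chi> \<circ> w) p = 0}"
    using fibre_binomials_subset_carrier[of X w]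
    by (auto simp: fibre_binomials_def weighted_sum_diff weighted_sum_single)
  then have "Idl\<^bsub>?R\<^esub> (fibre_binomials X w) \<subseteq>
      {p \<in> carrier ?R. \<forall>\<chi>. weighted_sum (\<chi> \<circ> w) p = 0}"
    by (rule R.genideal_minimal[rotated]) (rule ideal_vanishing_weighted_sums, erule w)
  moreover have "p \<in> Idl\<^bsub>?R\<^esub> (fibre_binomials X w)"
    if "p \<in> carrier ?R" "\<forall>\<chi>. weighted_sum (\<chi> \<circ> w) p = 0" for p
  proof (rule mem_ideal_if_weighted_sums_vanish)
    show "ideal (Idl\<^bsub>?R\<^esub> (fibre_binomials X w)) ?R"
      by (rule R.genideal_ideal[OF fibre_binomials_subset_carrier])
    show "fibre_binomials X w \<subseteq> Idl\<^bsub>?R\<^esub> (fibre_binomials X w)"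
      by (rule R.genideal_self[OF fibre_binomials_subset_carrier])
    show "weighted_sum (\<chi> \<circ> w) p = 0" for \<chi> using that(2) by blast
  qed (rule that(1))
  ultimately show ?thesis by (intro equalityI subsetI) auto
qed

section \<open>Differences of squares of variables\<close>

text \<open>
  The parities are recorded for all variables, the degree only in the variables from the finite set
  \<open>V\<close>; for monomials in \<open>K[x : x \<in> V]\<close> this is the total degree.
\<close>

definition parity_degree :: "'v set \<Rightarrow> ('v \<Rightarrow>\<^sub>0 nat) \<Rightarrow> 'v set \<times> nat" where
  "parity_degree V u = ({i. odd (Poly_Mapping.lookup u i)}, \<Sum>i \<in> V. Poly_Mapping.lookup u i)"

lemma parity_degree_cong:
  "parity_degree V u = parity_degree V v \<Longrightarrow> parity_degree V (m + u) = parity_degree V (m + v)"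
  by (simp add: parity_degree_def Poly_Mapping.lookup_add sum.distrib set_eq_iff)

lemma parity_degree_double:
  assumes "finite V" "i \<in> V"
  shows "parity_degree V (Poly_Mapping.single i 2) = ({}, 2)"
  using assms by (auto simp: parity_degree_def lookup_single when_def split: if_splits)

lemma mvar_power: "mvar v ^ k = Poly_Mapping.single (Poly_Mapping.single v k) 1"
  by (induction k) (simp_all add: mvar_def Poly_Mapping.mult_single flip: Poly_Mapping.single_add)

text \<open>
  Each replacement of a factor \<open>x\<^sub>i\<^sup>2\<close> with \<open>i \<noteq> k\<close> by \<open>x\<^sub>k\<^sup>2\<close> changes the monomial by an element of \<open>J\<close>,
  keeps parities and degree, and lowers the total exponent outside \<open>k\<close>, so the process stops.
\<close>

lemma reduce_monomial:
  assumes J: "ideal J (mpol_ring V :: ('v, 'k::comm_ring_1) mpol ring)"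
    and gens: "\<And>i j. i \<in> V \<Longrightarrow> j \<in> V \<Longrightarrow> mvar i ^ 2 - mvar j ^ 2 \<in> J"
    and V: "finite V" "k \<in> V"
  shows "Poly_Mapping.keys u \<subseteq> V \<Longrightarrow>
    \<exists>u'. Poly_Mapping.keys u' \<subseteq> V \<and> parity_degree V u' = parity_degree V u \<and>
      Poly_Mapping.single u 1 - Poly_Mapping.single u' 1 \<in> J \<and>
      (\<forall>i \<in> V - {k}. Poly_Mapping.lookup u' i < 2)"
proof (induction "\<Sum>i \<in> V - {k}. Poly_Mapping.lookup u i" arbitrary: u rule: less_induct)
  case less
  show ?case
  proof (cases "\<forall>i \<in> V - {k}. Poly_Mapping.lookup u i < 2")
    case True
    then show ?thesis using less.prems ideal_zero[OF J] by (intro exI[of _ u]) auto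
  next
    case False
    then obtain i where i: "i \<in> V" "i \<noteq> k" "2 \<le> Poly_Mapping.lookup u i"
      by (metis DiffD1 DiffD2 insertI1 not_less)
    define d where "d = u - Poly_Mapping.single i 2"
    define u1 where "u1 = d + Poly_Mapping.single k 2"
    have u: "u = d + Poly_Mapping.single i 2"
      unfolding d_def using i
      by (intro poly_mapping_eqI) (auto simp: lookup_minus Poly_Mapping.lookup_add lookup_single when_def)
    have dV: "Poly_Mapping.keys d \<subseteq> V"
      using less.prems by (auto simp: d_def in_keys_iff lookup_minus)
    have u1V: "Poly_Mapping.keys u1 \<subseteq> V"
      unfolding u1_def using Poly_Mapping.keys_add[of d "Poly_Mapping.single k 2"] dV V by auto
    have smaller: "(\<Sum>i \<in> V - {k}. Poly_Mapping.lookup u1 i) < (\<Sum>i \<in> V - {k}. Poly_Mapping.lookup u i)"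
      unfolding u u1_def using V i
      by (intro sum_strict_mono_ex1) (auto simp: Poly_Mapping.lookup_add lookup_single when_def)
    have class1: "parity_degree V u1 = parity_degree V u"
      unfolding u u1_def by (rule parity_degree_cong) (simp add: parity_degree_double V i)
    have "Poly_Mapping.single d 1 * (mvar i ^ 2 - mvar k ^ 2) \<in> J"
      by (intro ideal_mult[OF J] gens V i single_in_mpol_ring dV)
    then have step: "Poly_Mapping.single u 1 - Poly_Mapping.single u1 1 \<in> J"
      by (simp add: u u1_def mvar_power right_diff_distrib Poly_Mapping.mult_single)
    obtain u' where u': "Poly_Mapping.keys u' \<subseteq> V" "parity_degree V u' = parity_degree V u1"
      "Poly_Mapping.single u1 1 - Poly_Mapping.single u' 1 \<in> J"
      "\<forall>i \<in> V - {k}. Poly_Mapping.lookup u' i < 2"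
      using less.hyps[OF smaller u1V] by blast
    have "Poly_Mapping.single u 1 - Poly_Mapping.single u' 1 \<in> J"
      using ideal_add[OF J step u'(3)] by simp
    then show ?thesis using u' class1 by metis
  qed
qed

text \<open>
  Exponents below 2 are given by their parities, and the remaining exponent, at \<open>k\<close>, by the degree.
\<close>

lemma reduced_monomial_unique:
  assumes V: "finite V" "k \<in> V"
    and supp: "Poly_Mapping.keys u \<subseteq> V" "Poly_Mapping.keys v \<subseteq> V"
    and eq: "parity_degree V u = parity_degree V v"
    and red: "\<forall>i \<in> V - {k}. Poly_Mapping.lookup u i < 2" "\<forall>i \<in> V - {k}. Poly_Mapping.lookup v i < 2"
  shows "u = v"
proof (rule poly_mapping_eqI)
  have parity: "even (Poly_Mapping.lookup u i) = even (Poly_Mapping.lookup v i)" for i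
    using eq by (auto simp: parity_degree_def set_eq_iff)
  have off: "Poly_Mapping.lookup u i = Poly_Mapping.lookup v i" if "i \<in> V - {k}" for i
  proof -
    have "Poly_Mapping.lookup u i < 2" "Poly_Mapping.lookup v i < 2" using red that by auto
    with parity[of i] show ?thesis by (auto simp: less_2_cases_iff)
  qed
  have "(\<Sum>i \<in> V. Poly_Mapping.lookup u i) = (\<Sum>i \<in> V. Poly_Mapping.lookup v i)"
    using eq by (simp add: parity_degree_def)
  then have "Poly_Mapping.lookup u k = Poly_Mapping.lookup v k"
    using off by (simp add: sum.remove[OF V])
  fix i
  show "Poly_Mapping.lookup u i = Poly_Mapping.lookup v i"
  proof (cases "i \<in> V")
    case True
    then show ?thesis using off \<open>Poly_Mapping.lookup u k = _\<close> by (cases "i = k") auto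
  next
    case False
    then have "Poly_Mapping.lookup u i = 0" "Poly_Mapping.lookup v i = 0"
      using supp by (auto simp: in_keys_iff)
    then show ?thesis by simp
  qed
qed

text \<open>
  Two monomials with the same parities and degree reduce to the same monomial modulo the ideal of
  the square differences, so their difference lies in it. The converse inclusion holds on
  generators, as \<open>x\<^sub>i\<^sup>2\<close> and \<open>x\<^sub>j\<^sup>2\<close> both have even exponents and degree 2.
\<close>

theorem genideal_square_differences:
  assumes V: "finite V"
  shows "Idl\<^bsub>mpol_ring V\<^esub> {mvar i ^ 2 - mvar j ^ 2 | i j. i \<in> V \<and> j \<in> V} =
         Idl\<^bsub>mpol_ring V\<^esub> (fibre_binomials V (parity_degree V) :: ('v, 'k::comm_ring_1) mpol set)"
    (is "Idl\<^bsub>?R\<^esub> ?S = Idl\<^bsub>?R\<^esub> ?F")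
proof -
  interpret R: cring ?R by (rule cring_mpol_ring)
  have SF: "?S \<subseteq> ?F"
  proof
    fix p assume "p \<in> ?S"
    then obtain i j where "i \<in> V" "j \<in> V" "p = mvar i ^ 2 - mvar j ^ 2" by blast
    then show "p \<in> ?F"
      unfolding fibre_binomials_def mvar_power
      by (auto simp: parity_degree_double[OF V] intro!: exI)
  qed
  have F: "?F \<subseteq> carrier ?R" by (rule fibre_binomials_subset_carrier)
  have S: "?S \<subseteq> carrier ?R" using SF F by blast
  have FS: "?F \<subseteq> Idl\<^bsub>?R\<^esub> ?S"
  proof
    let ?J = "Idl\<^bsub>?R\<^esub> ?S"
    have J: "ideal ?J ?R" by (rule R.genideal_ideal[OF S])
    fix p assume "p \<in> ?F"
    then obtain u v where p: "p = Poly_Mapping.single u 1 - Poly_Mapping.single v 1"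
      and uv: "Poly_Mapping.keys u \<subseteq> V" "Poly_Mapping.keys v \<subseteq> V"
      and eq: "parity_degree V u = parity_degree V v"
      by (auto simp: fibre_binomials_def)
    show "p \<in> ?J"
    proof (cases "V = {}")
      case True
      then show ?thesis using uv p ideal_zero[OF J] by simp
    next
      case False
      then obtain k where k: "k \<in> V" by blast
      have gens: "mvar i ^ 2 - mvar j ^ 2 \<in> ?J" if "i \<in> V" "j \<in> V" for i j
        using R.genideal_self[OF S] that by blast
      obtain u' where u': "Poly_Mapping.keys u' \<subseteq> V" "parity_degree V u' = parity_degree V u"
        "Poly_Mapping.single u 1 - Poly_Mapping.single u' 1 \<in> ?J"
        "\<forall>i \<in> V - {k}. Poly_Mapping.lookup u' i < 2"
        using reduce_monomial[OF J gens V k uv(1)] by blast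
      obtain v' where v': "Poly_Mapping.keys v' \<subseteq> V" "parity_degree V v' = parity_degree V v"
        "Poly_Mapping.single v 1 - Poly_Mapping.single v' 1 \<in> ?J"
        "\<forall>i \<in> V - {k}. Poly_Mapping.lookup v' i < 2"
        using reduce_monomial[OF J gens V k uv(2)] by blast
      have "u' = v'"
        by (rule reduced_monomial_unique[OF V k]) (use u' v' eq in auto)
      then show ?thesis using ideal_diff[OF J u'(3) v'(3)] by (simp add: p)
    qed
  qed
  show ?thesis
    using R.genideal_minimal[OF R.genideal_ideal[OF S] FS]
      R.genideal_minimal[OF R.genideal_ideal[OF F]] SF R.genideal_self[OF F] by blast
qed

section \<open>The edge substitution on monomials\<close>

text \<open>
  A monomial in the edges is a multigraph supported on these edges. Its image under the edge
  substitution has as exponents the degrees of the vertices in this multigraph.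
\<close>

definition vertex_degrees :: "('v set \<Rightarrow>\<^sub>0 nat) \<Rightarrow> ('v \<Rightarrow>\<^sub>0 nat)" where
  "vertex_degrees a = (\<Sum>e \<in> Poly_Mapping.keys a. \<Sum>i \<in> e. Poly_Mapping.single i (Poly_Mapping.lookup a e))"

lemma vertex_degrees_superset:
  assumes "finite S" "Poly_Mapping.keys a \<subseteq> S"
  shows "vertex_degrees a = (\<Sum>e \<in> S. \<Sum>i \<in> e. Poly_Mapping.single i (Poly_Mapping.lookup a e))"
  unfolding vertex_degrees_def using assms
  by (intro sum.mono_neutral_left) (auto simp: in_keys_iff)

lemma vertex_degrees_add: "vertex_degrees (a + b) = vertex_degrees a + vertex_degrees b"
  using Poly_Mapping.keys_add[of a b]
  by (simp add: vertex_degrees_superset[where S = "Poly_Mapping.keys a \<union> Poly_Mapping.keys b"]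
      Poly_Mapping.lookup_add Poly_Mapping.single_add sum.distrib)

lemma vertex_degrees_zero: "vertex_degrees 0 = 0"
  by (simp add: vertex_degrees_def)

lemma vertex_degrees_sum: "vertex_degrees (sum f A) = (\<Sum>x \<in> A. vertex_degrees (f x))"
  by (induction A rule: infinite_finite_induct)
    (simp_all add: vertex_degrees_add vertex_degrees_zero)

lemma vertex_degrees_single:
  "vertex_degrees (Poly_Mapping.single e k) = (\<Sum>i \<in> e. Poly_Mapping.single i k)"
  by (simp add: vertex_degrees_superset[where S = "{e}"])

lemma prod_monomials:
  "(\<Prod>x \<in> A. Poly_Mapping.single (f x) 1) = (Poly_Mapping.single (sum f A) 1 :: ('v, 'k::comm_ring_1) mpol)"
  by (induction A rule: infinite_finite_induct) (simp_all add: Poly_Mapping.mult_single)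

lemma euler_hom_single:
  "euler_hom (Poly_Mapping.single a c) = Poly_Mapping.single (vertex_degrees a) c"
proof -
  have "(\<Prod>i \<in> e. mvar i) ^ k = (Poly_Mapping.single (\<Sum>i \<in> e. Poly_Mapping.single i k) 1 :: ('a, 'b) mpol)"
    for e k by (simp add: prod_power_distrib mvar_power prod_monomials)
  then show ?thesis
    by (simp add: euler_hom_def msubst_single mconst_def Poly_Mapping.mult_single
        vertex_degrees_def prod_monomials)
qed

text \<open>
  This transports membership criteria along the edge substitution: by linearity only monomials
  matter, and the substitution maps monomials to monomials.
\<close>

lemma weighted_sum_euler_hom:
  "weighted_sum \<chi> (euler_hom p) = weighted_sum (\<chi> \<circ> vertex_degrees) p"
proof (induction p rule: mpol_induct)
  case zero
  show ?case by (simp add: euler_hom_def msubst_def)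
next
  case (add p q)
  then show ?case by (simp add: euler_hom_def msubst_add weighted_sum_add)
qed (simp add: euler_hom_single weighted_sum_single)

section \<open>The lattice in terms of parities and degrees\<close>

definition edge_exponent :: "'e list \<Rightarrow> nat vec \<Rightarrow> ('e \<Rightarrow>\<^sub>0 nat)" where
  "edge_exponent es \<alpha> = (\<Sum>j<length es. Poly_Mapping.single (es ! j) (\<alpha> $ j))"

lemma tmonom_eq: "tmonom es \<alpha> = Poly_Mapping.single (edge_exponent es \<alpha>) 1"
  by (simp add: tmonom_def edge_exponent_def mvar_power prod_monomials)

lemma keys_edge_exponent: "Poly_Mapping.keys (edge_exponent es \<alpha>) \<subseteq> set es"
  unfolding edge_exponent_def
  by (rule order_trans[OF Poly_Mapping.keys_sum]) (auto split: if_splits)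

lemma edge_exponent_surj:
  assumes "distinct es" "Poly_Mapping.keys a \<subseteq> set es"
  shows "\<exists>\<alpha> \<in> carrier_vec (length es). edge_exponent es \<alpha> = a"
proof
  let ?\<alpha> = "vec (length es) (\<lambda>j. Poly_Mapping.lookup a (es ! j))"
  have "edge_exponent es ?\<alpha> = (\<Sum>e \<in> set es. Poly_Mapping.single e (Poly_Mapping.lookup a e))"
    unfolding edge_exponent_def
    by (rule sum.reindex_bij_betw[OF bij_betw_nth, of _ _ _ "\<lambda>e. Poly_Mapping.single e (Poly_Mapping.lookup a e)",
          THEN trans[rotated], OF assms(1) refl refl]) simp
  also have "\<dots> = a"
    using assms(2) by (intro poly_mapping_eqI) (auto simp: lookup_sum lookup_single when_def in_keys_iff)
  finally show "edge_exponent es ?\<alpha> = a" .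
qed simp

lemma lookup_vertex_degrees_edge_exponent:
  assumes "\<forall>e \<in> set es. finite e"
  shows "Poly_Mapping.lookup (vertex_degrees (edge_exponent es \<alpha>)) i =
           (\<Sum>j<length es. if i \<in> es ! j then \<alpha> $ j else 0)"
  unfolding edge_exponent_def vertex_degrees_sum vertex_degrees_single lookup_sum
  using assms by (intro sum.cong) (auto simp: lookup_single when_def)

text \<open>The handshaking lemma: each edge is counted at both of its ends.\<close>

lemma degree_vertex_degrees_edge_exponent:
  assumes "finite V" and edges: "\<forall>e \<in> set es. e \<subseteq> V \<and> card e = 2"
  shows "(\<Sum>i \<in> V. Poly_Mapping.lookup (vertex_degrees (edge_exponent es \<alpha>)) i) =
           2 * (\<Sum>j<length es. \<alpha> $ j)"
proof -
  have "\<forall>e \<in> set es. finite e"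
    using edges assms(1) finite_subset by blast
  then have "(\<Sum>i \<in> V. Poly_Mapping.lookup (vertex_degrees (edge_exponent es \<alpha>)) i) =
      (\<Sum>i \<in> V. \<Sum>j<length es. if i \<in> es ! j then \<alpha> $ j else 0)"
    by (simp add: lookup_vertex_degrees_edge_exponent)
  also have "\<dots> = (\<Sum>j<length es. \<Sum>i \<in> V. if i \<in> es ! j then \<alpha> $ j else 0)"
    by (rule sum.swap)
  also have "\<dots> = (\<Sum>j<length es. 2 * \<alpha> $ j)"
  proof (rule sum.cong[OF refl])
    fix j assume "j \<in> {..<length es}"
    then have "V \<inter> es ! j = es ! j" "card (es ! j) = 2"
      using edges by auto
    then show "(\<Sum>i \<in> V. if i \<in> es ! j then \<alpha> $ j else 0) = 2 * \<alpha> $ j"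
      using assms(1) by (simp flip: sum.inter_restrict)
  qed
  finally show ?thesis by (simp add: sum_distrib_left)
qed

text \<open>
  The entries of \<open>B\<alpha>\<close> are the vertex degrees of \<open>\<alpha>\<close>, so evenness of \<open>B(\<alpha> - \<beta>)\<close> compares parities. By
  handshaking, the condition that the entries of \<open>\<alpha> - \<beta>\<close> sum to zero compares degrees.
\<close>

lemma eulerian_lattice_iff_parity_degree:
  assumes edges: "\<forall>e \<in> set es. e \<subseteq> {1..n} \<and> card e = 2"
    and \<alpha>: "\<alpha> \<in> carrier_vec (length es)" and \<beta>: "\<beta> \<in> carrier_vec (length es)"
  shows "map_vec int \<alpha> - map_vec int \<beta> \<in> eulerian_lattice n es \<longleftrightarrow>
    parity_degree {1..n} (vertex_degrees (edge_exponent es \<alpha>)) =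
    parity_degree {1..n} (vertex_degrees (edge_exponent es \<beta>))"
proof -
  let ?\<theta> = "map_vec int \<alpha> - map_vec int \<beta>"
  let ?d = "\<lambda>\<gamma> i. Poly_Mapping.lookup (vertex_degrees (edge_exponent es \<gamma>)) i"
  have fin: "\<forall>e \<in> set es. finite e"
    using edges finite_subset by blast
  note d = lookup_vertex_degrees_edge_exponent[OF fin]
  \<comment> \<open>row \<open>i\<close> of the matrix belongs to the vertex \<open>i + 1\<close>\<close>
  have row: "(incidence_mat n es *\<^sub>v ?\<theta>) $ i = int (?d \<alpha> (i + 1)) - int (?d \<beta> (i + 1))" if "i < n" for i
  proof -
    have "(incidence_mat n es *\<^sub>v ?\<theta>) $ i =
        (\<Sum>j<length es. (if i + 1 \<in> es ! j then 1 else 0) * (int (\<alpha> $ j) - int (\<beta> $ j)))"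
      using \<alpha> \<beta> that
      by (auto simp: incidence_mat_def scalar_prod_def lessThan_atLeast0 intro!: sum.cong)
    also have "\<dots> = (\<Sum>j<length es. int (if i + 1 \<in> es ! j then \<alpha> $ j else 0) -
        int (if i + 1 \<in> es ! j then \<beta> $ j else 0))"
      by (intro sum.cong) auto
    finally show ?thesis by (simp add: d sum_subtractf)
  qed
  have outside: "?d \<gamma> i = 0" if "i \<notin> {1..n}" for \<gamma> i
  proof -
    have "i \<notin> es ! j" if "j < length es" for j
      using bspec[OF edges nth_mem[OF that]] \<open>i \<notin> {1..n}\<close> by blast
    then show ?thesis by (simp add: d)
  qed
  have "(\<forall>i<n. even ((incidence_mat n es *\<^sub>v ?\<theta>) $ i)) \<longleftrightarrow>
      (\<forall>i<n. even (?d \<alpha> (Suc i)) = even (?d \<beta> (Suc i)))"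
    by (simp add: row)
  also have "\<dots> \<longleftrightarrow> (\<forall>i \<in> {1..n}. even (?d \<alpha> i) = even (?d \<beta> i))"
    unfolding image_Suc_lessThan[symmetric] by auto
  also have "\<dots> \<longleftrightarrow> {i. odd (?d \<alpha> i)} = {i. odd (?d \<beta> i)}"
    using outside by (auto simp: set_eq_iff)
  finally have parity: "(\<forall>i<n. even ((incidence_mat n es *\<^sub>v ?\<theta>) $ i)) \<longleftrightarrow>
      {i. odd (?d \<alpha> i)} = {i. odd (?d \<beta> i)}" .
  have "(\<Sum>j<length es. ?\<theta> $ j) = int (\<Sum>j<length es. \<alpha> $ j) - int (\<Sum>j<length es. \<beta> $ j)"
    using \<alpha> \<beta> by (simp add: sum_subtractf)
  then have degree: "(\<Sum>j<length es. ?\<theta> $ j) = 0 \<longleftrightarrow>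
      (\<Sum>i \<in> {1..n}. ?d \<alpha> i) = (\<Sum>i \<in> {1..n}. ?d \<beta> i)"
    unfolding degree_vertex_degrees_edge_exponent[OF finite_atLeastAtMost edges]
    by linarith
  show ?thesis
    using \<alpha> \<beta> parity degree by (simp add: eulerian_lattice_def parity_degree_def)
qed

lemma lattice_ideal_eq_fibre_ideal:
  assumes edges: "\<forall>e \<in> set es. e \<subseteq> {1..n} \<and> card e = 2" and "distinct es"
  shows "lattice_ideal es (eulerian_lattice n es) =
    Idl\<^bsub>mpol_ring (set es)\<^esub> (fibre_binomials (set es) (parity_degree {1..n} \<circ> vertex_degrees))"
  unfolding lattice_ideal_def
proof (rule arg_cong[where f = "\<lambda>S. Idl\<^bsub>mpol_ring (set es)\<^esub> S"], intro equalityI subsetI)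
  fix p :: "(nat set, 'k::field) mpol"
  assume "p \<in> fibre_binomials (set es) (parity_degree {1..n} \<circ> vertex_degrees)"
  then obtain a b where p: "p = Poly_Mapping.single a 1 - Poly_Mapping.single b 1"
    and ab: "Poly_Mapping.keys a \<subseteq> set es" "Poly_Mapping.keys b \<subseteq> set es"
    and eq: "parity_degree {1..n} (vertex_degrees a) = parity_degree {1..n} (vertex_degrees b)"
    by (auto simp: fibre_binomials_def)
  from edge_exponent_surj[OF \<open>distinct es\<close> ab(1)] edge_exponent_surj[OF \<open>distinct es\<close> ab(2)]
  obtain \<alpha> \<beta> where "\<alpha> \<in> carrier_vec (length es)" "edge_exponent es \<alpha> = a"
    "\<beta> \<in> carrier_vec (length es)" "edge_exponent es \<beta> = b" by blast
  then show "p \<in> {tmonom es \<alpha> - tmonom es \<beta> | \<alpha> \<beta>.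
      \<alpha> \<in> carrier_vec (length es) \<and> \<beta> \<in> carrier_vec (length es) \<and>
      map_vec int \<alpha> - map_vec int \<beta> \<in> eulerian_lattice n es}"
    using p eq eulerian_lattice_iff_parity_degree[OF edges, of \<alpha> \<beta>]
    by (fastforce simp: tmonom_eq)
next
  fix p :: "(nat set, 'k::field) mpol"
  assume "p \<in> {tmonom es \<alpha> - tmonom es \<beta> | \<alpha> \<beta>.
      \<alpha> \<in> carrier_vec (length es) \<and> \<beta> \<in> carrier_vec (length es) \<and>
      map_vec int \<alpha> - map_vec int \<beta> \<in> eulerian_lattice n es}"
  then obtain \<alpha> \<beta> where p: "p = tmonom es \<alpha> - tmonom es \<beta>"
    and "\<alpha> \<in> carrier_vec (length es)" "\<beta> \<in> carrier_vec (length es)"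
      "map_vec int \<alpha> - map_vec int \<beta> \<in> eulerian_lattice n es"
    by blast
  then show "p \<in> fibre_binomials (set es) (parity_degree {1..n} \<circ> vertex_degrees)"
    using eulerian_lattice_iff_parity_degree[OF edges, of \<alpha> \<beta>] keys_edge_exponent[of es]
    by (auto simp: p tmonom_eq fibre_binomials_def)
qed

section \<open>Eulerian ideals are lattice ideals\<close>

theorem proposition2p7:
  fixes n s :: nat and E :: "nat set set" and es :: "nat set list"
  assumes "simple_graph {1..n} E"
    and "s = card E" and "s \<ge> 2"
    and "distinct es" and "set es = E"
  shows "(eulerian_ideal {1..n} E :: (nat set, 'k::field) mpol set) =
           lattice_ideal es (eulerian_lattice n es)"
proof -
  let ?V = "{1..n}"
  have edges: "\<forall>e \<in> set es. e \<subseteq> ?V \<and> card e = 2"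
    using assms(1,5) unfolding simple_graph_def by fastforce
  have cong: "(parity_degree ?V \<circ> vertex_degrees) (m + u) = (parity_degree ?V \<circ> vertex_degrees) (m + v)"
    if "(parity_degree ?V \<circ> vertex_degrees) u = (parity_degree ?V \<circ> vertex_degrees) v" for m u v
    using that unfolding comp_def vertex_degrees_add by (rule parity_degree_cong)
  have hom: "euler_hom p \<in> carrier (mpol_ring ?V)" if "p \<in> carrier (mpol_ring E)"
    for p :: "(nat set, 'k) mpol"
    using ring_hom_closed[OF euler_hom_ring_hom[OF assms(1)] that] .
  have square_ideal: "Idl\<^bsub>mpol_ring ?V\<^esub> (fibre_binomials ?V (parity_degree ?V)) =
      {p \<in> carrier (mpol_ring ?V). \<forall>\<chi>. weighted_sum (\<chi> \<circ> parity_degree ?V) p = (0 :: 'k)}"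
    by (rule genideal_fibre_binomials) (erule parity_degree_cong)
  have "eulerian_ideal ?V E =
      {p \<in> carrier (mpol_ring E). \<forall>\<chi>. weighted_sum (\<chi> \<circ> parity_degree ?V) (euler_hom p) = (0 :: 'k)}"
    unfolding eulerian_ideal_def genideal_square_differences[OF finite_atLeastAtMost]
      square_ideal
    by (intro Collect_cong conj_cong refl) (simp add: hom del: One_nat_def)
  also have "\<dots> = {p \<in> carrier (mpol_ring E).
      \<forall>\<chi>. weighted_sum (\<chi> \<circ> (parity_degree ?V \<circ> vertex_degrees)) p = (0 :: 'k)}"
    by (simp add: weighted_sum_euler_hom comp_assoc)
  also have "\<dots> = Idl\<^bsub>mpol_ring E\<^esub> (fibre_binomials E (parity_degree ?V \<circ> vertex_degrees))"
    by (rule genideal_fibre_binomials[symmetric]) (rule cong)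
  also have "\<dots> = lattice_ideal es (eulerian_lattice n es)"
    by (rule lattice_ideal_eq_fibre_ideal[OF edges assms(4), unfolded assms(5), symmetric])
  finally show ?thesis .
qed

end
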